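(* Let $f:\Sigma\to\mathbf{L}^3$ be a mixed type surface, $p\in\Sigma$ a non-degenerate lightlike point, and $(\bar U;u,v)$ an L-coordinate system centered at $p$, so that $ds^2=E\,du^2+G\,dv^2$. Set $\epsilon=1$ if $(u,v)$ is p-oriented and $\epsilon=-1$ if $(u,v)$ is n-oriented. Then there exist an open neighborhood $U\subset\bar U$ of $p$ and a smooth map $\psi:U\to\mathbf{L}^3$ such that $$f_u\times f_v=\epsilon\sqrt{E}\,(f_v-G\psi).$$ Moreover, $\psi$ satisfies $$\langle\psi,\psi\rangle=0,\qquad \langle\psi,f_u\rangle=0,\qquad \langle\psi,f_v\rangle=1 .$$
   Context: $\mathbf{L}^3$ is $\mathbb R^3$ with $\langle x,y\rangle=x_1y_1+x_2y_2-x_3y_3$; $|x|:=\sqrt{|\langle x,x\rangle|}$. A non-zero vector is spacelike/timelike/lightlike if $\langle x,x\rangle$ is $>0$/$<0$/$=0$. The vector product is $v\times w:=S(v\times_E w)$, with $S=\mathrm{diag}(1,1,-1)$ and $\times_E$ the Euclidean cross product. A surface is an embedding $f:\Sigma\to\mathbf{L}^3$ of a connected smooth 2-manifold; $ds^2=f^*\langle\cdot,\cdot\rangle$. A point is spacelike/timelike/lightlike if $ds^2$ is positive definite/indefinite/degenerate there; $LD$ is the set of lightlike points. $f$ is of mixed type if there are spacelike, timelike and lightlike points. In coordinates $ds^2=E\,du^2+2F\,du\,dv+G\,dv^2$, a lightlike point $p$ is non-degenerate if $d(EG-F^2)(p)\ne0$. An L-coordinate system centered at a non-degenerate lightlike point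 $p$ is a coordinate system $(u,v)$ with $p=(0,0)$, $\langle f_u,f_v\rangle=0$, and $\partial_v$ null at every lightlike point (i.e. $ds^2(\partial_v,\cdot)=0$ on $LD$); thus $ds^2=E\,du^2+G\,dv^2$, $E>0$, $G|_{LD}=0$. If $v$ is spacelike and $w$ is lightlike and orthogonal to $v$, then $v\times w=\pm|v|w$; the pair $\{v,w\}$ is p-oriented if the sign is $+$ and n-oriented if it is $-$. The L-coordinate system is p-oriented (n-oriented) if $\{f_u,f_v\}$ is p-oriented (n-oriented) along $LD$ near $p$. (A map $\psi$ as in the claim is called an L-Gauss map.) *)

theory Defs
  imports "HOL-Analysis.Analysis"
begin

section \<open>Lorentz-Minkowski 3-space\<close>

definition lor :: "real^3 \<Rightarrow> real^3 \<Rightarrow> real" where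
  "lor x y = x$1 * y$1 + x$2 * y$2 - x$3 * y$3"

definition lnorm :: "real^3 \<Rightarrow> real" where
  "lnorm x = sqrt \<bar>lor x x\<bar>"

definition spacelike :: "real^3 \<Rightarrow> bool" where
  "spacelike x \<longleftrightarrow> x \<noteq> 0 \<and> lor x x > 0"

definition lightlike :: "real^3 \<Rightarrow> bool" where
  "lightlike x \<longleftrightarrow> x \<noteq> 0 \<and> lor x x = 0"

definition lcross :: "real^3 \<Rightarrow> real^3 \<Rightarrow> real^3" where
  "lcross v w = (let x = cross3 v w in vector [x$1, x$2, - x$3])"

definition p_oriented_pair :: "real^3 \<Rightarrow> real^3 \<Rightarrow> bool" where
  "p_oriented_pair v w \<longleftrightarrow>
     spacelike v \<and> lightlike w \<and> lor v w = 0 \<and> lcross v w = lnorm v *\<^sub>R w"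

definition n_oriented_pair :: "real^3 \<Rightarrow> real^3 \<Rightarrow> bool" where
  "n_oriented_pair v w \<longleftrightarrow>
     spacelike v \<and> lightlike w \<and> lor v w = 0 \<and> lcross v w = - (lnorm v *\<^sub>R w)"


section \<open>Smooth maps between Euclidean spaces\<close>

text \<open>Both predicates are only meant for open sets: derivatives are full derivatives at the
  points of the set.\<close>

primrec higher_differentiable_on ::
    "'a::real_normed_vector set \<Rightarrow> ('a \<Rightarrow> 'b::real_normed_vector) \<Rightarrow> nat \<Rightarrow> bool" where
  "higher_differentiable_on S f 0 \<longleftrightarrow> continuous_on S f"
| "higher_differentiable_on S f (Suc n) \<longleftrightarrow>
     (\<forall>x\<in>S. f differentiable (at x)) \<and>
     (\<forall>v. higher_differentiable_on S (\<lambda>x. frechet_derivative f (at x) v) n)"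

definition smooth_on ::
    "'a::real_normed_vector set \<Rightarrow> ('a \<Rightarrow> 'b::real_normed_vector) \<Rightarrow> bool" where
  "smooth_on S f \<longleftrightarrow> (\<forall>n. higher_differentiable_on S f n)"


section \<open>Smooth 2-manifolds\<close>

text \<open>A chart is a pair of its domain and its coordinate map. The values of the coordinate map
  outside the domain are irrelevant.\<close>

type_synonym 'a chart = "'a set \<times> ('a \<Rightarrow> real^2)"

definition param :: "'a chart \<Rightarrow> real^2 \<Rightarrow> 'a" where
  "param c = inv_into (fst c) (snd c)"

definition is_chart :: "'a topology \<Rightarrow> 'a chart \<Rightarrow> bool" where
  "is_chart X c \<longleftrightarrow>
     openin X (fst c) \<and> open (snd c ` fst c) \<and>
     homeomorphic_map (subtopology X (fst c)) (top_of_set (snd c ` fst c)) (snd c)"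

definition compatible_charts :: "'a chart \<Rightarrow> 'a chart \<Rightarrow> bool" where
  "compatible_charts c d \<longleftrightarrow>
     smooth_on (snd c ` (fst c \<inter> fst d)) (snd d \<circ> param c) \<and>
     smooth_on (snd d ` (fst c \<inter> fst d)) (snd c \<circ> param d)"

text \<open>The atlas of a smooth 2-manifold is required to be maximal, so its members are exactly
  the local coordinate systems.\<close>

definition smooth_2_manifold :: "'a topology \<Rightarrow> 'a chart set \<Rightarrow> bool" where
  "smooth_2_manifold X A \<longleftrightarrow>
     Hausdorff_space X \<and> second_countable X \<and>
     (\<forall>c\<in>A. is_chart X c) \<and>
     (\<Union>c\<in>A. fst c) = topspace X \<and>
     (\<forall>c\<in>A. \<forall>d\<in>A. compatible_charts c d) \<and>
     (\<forall>c. is_chart X c \<and> (\<forall>d\<in>A. compatible_charts c d) \<longrightarrow> c \<in> A)"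

definition smooth_map_on :: "'a chart set \<Rightarrow> 'a set \<Rightarrow> ('a \<Rightarrow> real^3) \<Rightarrow> bool" where
  "smooth_map_on A U g \<longleftrightarrow> (\<forall>c\<in>A. smooth_on (snd c ` (fst c \<inter> U)) (g \<circ> param c))"


section \<open>Surfaces in Lorentz-Minkowski 3-space\<close>

text \<open>The differential of \<open>f\<close> at \<open>q\<close>, with tangent vectors written in the coordinate basis of
  the chart \<open>c\<close>.\<close>

definition differential :: "('a \<Rightarrow> real^3) \<Rightarrow> 'a chart \<Rightarrow> 'a \<Rightarrow> real^2 \<Rightarrow> real^3" where
  "differential f c q = frechet_derivative (f \<circ> param c) (at (snd c q))"

definition surface :: "'a topology \<Rightarrow> 'a chart set \<Rightarrow> ('a \<Rightarrow> real^3) \<Rightarrow> bool" where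
  "surface X A f \<longleftrightarrow>
     smooth_2_manifold X A \<and> connected_space X \<and>
     smooth_map_on A (topspace X) f \<and>
     (\<forall>c\<in>A. \<forall>q\<in>fst c. inj (differential f c q)) \<and>
     embedding_map X euclidean f"

abbreviation e_u :: "real^2" where "e_u \<equiv> axis 1 1"
abbreviation e_v :: "real^2" where "e_v \<equiv> axis 2 1"

definition f_u :: "('a \<Rightarrow> real^3) \<Rightarrow> 'a chart \<Rightarrow> 'a \<Rightarrow> real^3" where
  "f_u f c q = differential f c q e_u"

definition f_v :: "('a \<Rightarrow> real^3) \<Rightarrow> 'a chart \<Rightarrow> 'a \<Rightarrow> real^3" where
  "f_v f c q = differential f c q e_v"

definition metric :: "('a \<Rightarrow> real^3) \<Rightarrow> 'a chart \<Rightarrow> 'a \<Rightarrow> real^2 \<Rightarrow> real^2 \<Rightarrow> real" where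
  "metric f c q a b = lor (differential f c q a) (differential f c q b)"

definition coeff_E :: "('a \<Rightarrow> real^3) \<Rightarrow> 'a chart \<Rightarrow> 'a \<Rightarrow> real" where
  "coeff_E f c q = metric f c q e_u e_u"

definition coeff_F :: "('a \<Rightarrow> real^3) \<Rightarrow> 'a chart \<Rightarrow> 'a \<Rightarrow> real" where
  "coeff_F f c q = metric f c q e_u e_v"

definition coeff_G :: "('a \<Rightarrow> real^3) \<Rightarrow> 'a chart \<Rightarrow> 'a \<Rightarrow> real" where
  "coeff_G f c q = metric f c q e_v e_v"

definition positive_definite_form :: "(real^2 \<Rightarrow> real^2 \<Rightarrow> real) \<Rightarrow> bool" where
  "positive_definite_form B \<longleftrightarrow> (\<forall>a. a \<noteq> 0 \<longrightarrow> B a a > 0)"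

definition indefinite_form :: "(real^2 \<Rightarrow> real^2 \<Rightarrow> real) \<Rightarrow> bool" where
  "indefinite_form B \<longleftrightarrow> (\<exists>a. B a a > 0) \<and> (\<exists>a. B a a < 0)"

definition degenerate_form :: "(real^2 \<Rightarrow> real^2 \<Rightarrow> real) \<Rightarrow> bool" where
  "degenerate_form B \<longleftrightarrow> (\<exists>a. a \<noteq> 0 \<and> (\<forall>b. B a b = 0))"

text \<open>The following properties of a point \<open>q\<close> do not depend on the chart around \<open>q\<close>. Since the
  atlas covers the manifold, requiring them in every chart around \<open>q\<close> is the same as requiring
  them in some chart around \<open>q\<close>.\<close>

definition spacelike_point ::
    "'a topology \<Rightarrow> 'a chart set \<Rightarrow> ('a \<Rightarrow> real^3) \<Rightarrow> 'a \<Rightarrow> bool" where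
  "spacelike_point X A f q \<longleftrightarrow>
     q \<in> topspace X \<and> (\<forall>c\<in>A. q \<in> fst c \<longrightarrow> positive_definite_form (metric f c q))"

definition timelike_point ::
    "'a topology \<Rightarrow> 'a chart set \<Rightarrow> ('a \<Rightarrow> real^3) \<Rightarrow> 'a \<Rightarrow> bool" where
  "timelike_point X A f q \<longleftrightarrow>
     q \<in> topspace X \<and> (\<forall>c\<in>A. q \<in> fst c \<longrightarrow> indefinite_form (metric f c q))"

definition lightlike_point ::
    "'a topology \<Rightarrow> 'a chart set \<Rightarrow> ('a \<Rightarrow> real^3) \<Rightarrow> 'a \<Rightarrow> bool" where
  "lightlike_point X A f q \<longleftrightarrow>
     q \<in> topspace X \<and> (\<forall>c\<in>A. q \<in> fst c \<longrightarrow> degenerate_form (metric f c q))"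

definition LD :: "'a topology \<Rightarrow> 'a chart set \<Rightarrow> ('a \<Rightarrow> real^3) \<Rightarrow> 'a set" where
  "LD X A f = {q. lightlike_point X A f q}"

definition mixed_type ::
    "'a topology \<Rightarrow> 'a chart set \<Rightarrow> ('a \<Rightarrow> real^3) \<Rightarrow> bool" where
  "mixed_type X A f \<longleftrightarrow>
     (\<exists>q. spacelike_point X A f q) \<and> (\<exists>q. timelike_point X A f q) \<and>
     (\<exists>q. lightlike_point X A f q)"

definition discriminant :: "('a \<Rightarrow> real^3) \<Rightarrow> 'a chart \<Rightarrow> 'a \<Rightarrow> real" where
  "discriminant f c q = coeff_E f c q * coeff_G f c q - (coeff_F f c q)\<^sup>2"

text \<open>At a lightlike point \<open>EG - F\<^sup>2\<close> vanishes, so a change of coordinates multiplies its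
  differential there by a non-zero factor (the square of the Jacobian determinant).\<close>

definition nondegenerate_lightlike_point ::
    "'a topology \<Rightarrow> 'a chart set \<Rightarrow> ('a \<Rightarrow> real^3) \<Rightarrow> 'a \<Rightarrow> bool" where
  "nondegenerate_lightlike_point X A f p \<longleftrightarrow>
     lightlike_point X A f p \<and>
     (\<forall>c\<in>A. p \<in> fst c \<longrightarrow>
        frechet_derivative (discriminant f c \<circ> param c) (at (snd c p)) \<noteq> (\<lambda>_. 0))"


section \<open>L-coordinate systems\<close>

definition L_coordinates ::
    "'a topology \<Rightarrow> 'a chart set \<Rightarrow> ('a \<Rightarrow> real^3) \<Rightarrow> 'a \<Rightarrow> 'a chart \<Rightarrow> bool" where
  "L_coordinates X A f p c \<longleftrightarrow>
     c \<in> A \<and> p \<in> fst c \<and> snd c p = 0 \<and>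
     (\<forall>q\<in>fst c. lor (f_u f c q) (f_v f c q) = 0) \<and>
     (\<forall>q\<in>fst c \<inter> LD X A f. \<forall>b. metric f c q e_v b = 0)"

definition p_oriented_coordinates ::
    "'a topology \<Rightarrow> 'a chart set \<Rightarrow> ('a \<Rightarrow> real^3) \<Rightarrow> 'a \<Rightarrow> 'a chart \<Rightarrow> bool" where
  "p_oriented_coordinates X A f p c \<longleftrightarrow>
     (\<exists>W. openin X W \<and> p \<in> W \<and> W \<subseteq> fst c \<and>
        (\<forall>q\<in>W \<inter> LD X A f. p_oriented_pair (f_u f c q) (f_v f c q)))"

definition n_oriented_coordinates ::
    "'a topology \<Rightarrow> 'a chart set \<Rightarrow> ('a \<Rightarrow> real^3) \<Rightarrow> 'a \<Rightarrow> 'a chart \<Rightarrow> bool" where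
  "n_oriented_coordinates X A f p c \<longleftrightarrow>
     (\<exists>W. openin X W \<and> p \<in> W \<and> W \<subseteq> fst c \<and>
        (\<forall>q\<in>W \<inter> LD X A f. n_oriented_pair (f_u f c q) (f_v f c q)))"

end

theory Submission
  imports Defs
begin

text \<open>
  Where \<open>G \<noteq> 0\<close> the equation forces \<open>\<psi> = (f\<^sub>v - \<epsilon> f\<^sub>u \<times> f\<^sub>v / \<surd>E) / G\<close>, and the difficulty is
  the smoothness of this quotient across the lightlike set \<open>G = 0\<close>. Instead of dividing by \<open>G\<close>,
  one can write the quotient so that it has a non-vanishing denominator.

  Put \<open>\<sigma> = \<epsilon> \<surd>E\<close> near \<open>p\<close>, where \<open>E > 0\<close>. The operator \<open>J = f\<^sub>u \<times> -\<close> preserves the Lorentzian plane orthogonal to \<open>f\<^sub>u\<close>,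
  satisfies \<open>J\<^sup>2 = \<sigma>\<^sup>2\<close> there and is skew for the Lorentz product. Its eigenspaces for \<open>\<sigma>\<close> and
  \<open>- \<sigma>\<close> in that plane are therefore the two null lines. Since \<open>f\<^sub>v\<close> lies in the plane,
  \<open>\<sigma> f\<^sub>v - J f\<^sub>v\<close> is an eigenvector for \<open>- \<sigma>\<close>. Projecting the constant time axis in the same way
  gives another eigenvector \<open>N\<close> for \<open>- \<sigma>\<close> (\<open>null_companion\<close>), and comparing the two gives
  \<open>\<langle>N, f\<^sub>v\<rangle> (\<sigma> f\<^sub>v - J f\<^sub>v) = \<sigma> G N\<close> (\<open>null_companion_identity\<close>). Hence \<open>\<psi> = N / \<langle>N, f\<^sub>v\<rangle>\<close> satisfies
  all four equations wherever \<open>\<langle>N, f\<^sub>v\<rangle> \<noteq> 0\<close> (\<open>L_Gauss_algebra\<close>).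

  At \<open>p\<close> itself \<open>f\<^sub>v\<close> is null, hence an eigenvector of \<open>J\<close>. The choice of \<open>\<epsilon>\<close> makes its
  eigenvalue \<open>\<sigma>\<close> (\<open>orientation_at_base_point\<close>), so \<open>f\<^sub>v\<close> and \<open>N\<close> span different null lines and
  \<open>\<langle>N, f\<^sub>v\<rangle> \<noteq> 0\<close>. By continuity this persists on a neighbourhood \<open>U\<close>, on which \<open>\<psi>\<close> is smooth as a
  combination of sums, products, square roots of positive functions and inverses of non-zero ones.
\<close>

section \<open>Calculus of smooth maps\<close>

lemma higher_differentiable_on_subset:
  "higher_differentiable_on S f n \<Longrightarrow> T \<subseteq> S \<Longrightarrow> higher_differentiable_on T f n"
  by (induction n arbitrary: f) (auto intro: continuous_on_subset)

lemma higher_differentiable_on_SucD: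
  "higher_differentiable_on S f (Suc n) \<Longrightarrow> higher_differentiable_on S f n"
proof (induction n arbitrary: f)
  case 0
  then show ?case
    by (auto intro!: continuous_at_imp_continuous_on differentiable_imp_continuous_within)
qed auto

lemma higher_differentiable_on_cong:
  assumes "open S" "higher_differentiable_on S f n" "\<And>x. x \<in> S \<Longrightarrow> f x = g x"
  shows "higher_differentiable_on S g n"
  using assms(2,3)
proof (induction n arbitrary: f g)
  case 0
  then show ?case by (auto cong: continuous_on_cong)
next
  case (Suc n)
  have D: "(g has_derivative frechet_derivative f (at x)) (at x)" if "x \<in> S" for x
    using Suc.prems that assms(1)
    by (auto simp: frechet_derivative_works intro: has_derivative_transform_within_open)
  have eq: "frechet_derivative g (at x) = frechet_derivative f (at x)" if "x \<in> S" for x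
    using frechet_derivative_at[OF D[OF that]] by simp
  have "higher_differentiable_on S (\<lambda>x. frechet_derivative g (at x) v) n" for v
  proof (rule Suc.IH)
    show "higher_differentiable_on S (\<lambda>x. frechet_derivative f (at x) v) n"
      using Suc.prems(1) by simp
  qed (simp add: eq)
  then show ?case
    using D by (auto simp: differentiable_def)
qed

text \<open>The closure properties below are inductions on the order, and in their step the derivative is
  known by a formula: this rule trades the choice operator \<open>frechet_derivative\<close> for that formula.\<close>

lemma higher_differentiable_on_SucI:
  assumes "open S" "\<And>x. x \<in> S \<Longrightarrow> (f has_derivative D x) (at x)"
    and "\<And>v. higher_differentiable_on S (\<lambda>x. D x v) n"
  shows "higher_differentiable_on S f (Suc n)"
proof -
  have "D x = frechet_derivative f (at x)" if "x \<in> S" for x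
    using frechet_derivative_at[OF assms(2)[OF that]] .
  then have "higher_differentiable_on S (\<lambda>x. frechet_derivative f (at x) v) n" for v
    by (intro higher_differentiable_on_cong[OF assms(1) assms(3)[of v]]) simp
  then show ?thesis
    using assms(2) by (auto simp: differentiable_def)
qed

lemma higher_differentiable_on_const: "higher_differentiable_on S (\<lambda>x. k) n"
  by (induction n arbitrary: k) (auto simp: frechet_derivative_const)

lemma higher_differentiable_on_add:
  assumes "open S" "higher_differentiable_on S f n" "higher_differentiable_on S g n"
  shows "higher_differentiable_on S (\<lambda>x. f x + g x) n"
  using assms(2,3)
proof (induction n arbitrary: f g)
  case 0
  then show ?case by (auto intro: continuous_on_add)
next
  case (Suc n)
  then have D: "(f has_derivative frechet_derivative f (at x)) (at x)"
    "(g has_derivative frechet_derivative g (at x)) (at x)" if "x \<in> S" for x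
    using that by (auto simp: frechet_derivative_works)
  then show ?case
    using Suc by (intro higher_differentiable_on_SucI[OF assms(1) has_derivative_add[OF D]]) auto
qed

lemma higher_differentiable_on_bilinear:
  assumes "bounded_bilinear B" "open S"
    "higher_differentiable_on S f n" "higher_differentiable_on S g n"
  shows "higher_differentiable_on S (\<lambda>x. B (f x) (g x)) n"
  using assms(3,4)
proof (induction n arbitrary: f g)
  case 0
  then show ?case
    using bounded_bilinear.continuous_on[OF assms(1)] by auto
next
  case (Suc n)
  then have D: "(f has_derivative frechet_derivative f (at x)) (at x)"
    "(g has_derivative frechet_derivative g (at x)) (at x)" if "x \<in> S" for x
    using that by (auto simp: frechet_derivative_works)
  show ?case
  proof (rule higher_differentiable_on_SucI[OF assms(2)])
    show "((\<lambda>x. B (f x) (g x)) has_derivative (\<lambda>v. B (f x) (frechet_derivative g (at x) v)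
        + B (frechet_derivative f (at x) v) (g x))) (at x)" if "x \<in> S" for x
      using bounded_bilinear.FDERIV[OF assms(1) D[OF that]] .
    show "higher_differentiable_on S (\<lambda>x. B (f x) (frechet_derivative g (at x) v)
        + B (frechet_derivative f (at x) v) (g x)) n" for v
      using Suc.prems higher_differentiable_on_SucD[OF Suc.prems(1)]
        higher_differentiable_on_SucD[OF Suc.prems(2)]
      by (intro higher_differentiable_on_add assms(2) Suc.IH) auto
  qed
qed

lemmas higher_differentiable_on_mult =
  higher_differentiable_on_bilinear[OF bounded_bilinear_mult]

lemma higher_differentiable_on_sum:
  assumes "open S" "finite I" "\<And>i. i \<in> I \<Longrightarrow> higher_differentiable_on S (f i) n"
  shows "higher_differentiable_on S (\<lambda>x. \<Sum>i\<in>I. f i x) n"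
  using assms(2,3)
  by (induction I rule: finite_induct)
    (auto intro!: higher_differentiable_on_const higher_differentiable_on_add assms(1))

lemma higher_differentiable_on_inverse:
  fixes f :: "'a::real_normed_vector \<Rightarrow> real"
  assumes "open S" "higher_differentiable_on S f n" "\<And>x. x \<in> S \<Longrightarrow> f x \<noteq> 0"
  shows "higher_differentiable_on S (\<lambda>x. inverse (f x)) n"
  using assms(2)
proof (induction n)
  case 0
  then show ?case using assms(3) by (auto intro!: continuous_on_inverse)
next
  case (Suc n)
  have IH: "higher_differentiable_on S (\<lambda>x. inverse (f x)) n"
    using Suc higher_differentiable_on_SucD by blast
  show ?case
  proof (rule higher_differentiable_on_SucI[OF assms(1)])
    show "((\<lambda>x. inverse (f x)) has_derivative
        (\<lambda>v. (-1) * (inverse (f x) * (frechet_derivative f (at x) v * inverse (f x))))) (at x)"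
      if "x \<in> S" for x
    proof -
      have "(f has_derivative frechet_derivative f (at x)) (at x)"
        using that Suc.prems by (simp add: frechet_derivative_works)
      from Deriv.has_derivative_inverse[OF assms(3)[OF that] this]
      show ?thesis by (simp add: mult.assoc)
    qed
    show "higher_differentiable_on S
        (\<lambda>x. (-1) * (inverse (f x) * (frechet_derivative f (at x) v * inverse (f x)))) n" for v
      using Suc.prems
      by (intro higher_differentiable_on_mult higher_differentiable_on_const assms(1) IH) auto
  qed
qed

lemma higher_differentiable_on_sqrt:
  fixes f :: "'a::real_normed_vector \<Rightarrow> real"
  assumes "open S" "higher_differentiable_on S f n" "\<And>x. x \<in> S \<Longrightarrow> f x > 0"
  shows "higher_differentiable_on S (\<lambda>x. sqrt (f x)) n"
  using assms(2)
proof (induction n)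
  case 0
  then show ?case by (auto intro!: continuous_on_real_sqrt)
next
  case (Suc n)
  have IH: "higher_differentiable_on S (\<lambda>x. sqrt (f x)) n"
    using Suc higher_differentiable_on_SucD by blast
  show ?case
  proof (rule higher_differentiable_on_SucI[OF assms(1)])
    show "((\<lambda>x. sqrt (f x)) has_derivative
        (\<lambda>v. frechet_derivative f (at x) v * (inverse (sqrt (f x)) * (1/2)))) (at x)"
      if "x \<in> S" for x
    proof -
      have "(f has_derivative frechet_derivative f (at x)) (at x)"
        using that Suc.prems by (simp add: frechet_derivative_works)
      from has_derivative_real_sqrt[OF assms(3)[OF that] this]
      show ?thesis by (simp add: mult.assoc)
    qed
    show "higher_differentiable_on S
        (\<lambda>x. frechet_derivative f (at x) v * (inverse (sqrt (f x)) * (1/2))) n" for v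
      using Suc.prems assms(3)
      by (intro higher_differentiable_on_mult higher_differentiable_on_const
          higher_differentiable_on_inverse assms(1) IH) fastforce+
  qed
qed

text \<open>The derivative of a composition at \<open>x\<close> evaluates the derivative of \<open>g\<close> in a direction that
  varies with \<open>x\<close>, whereas the induction hypothesis only covers fixed directions. Expanding the
  direction in a basis separates the two.\<close>

lemma higher_differentiable_on_compose:
  fixes h :: "'a::real_normed_vector \<Rightarrow> 'b::euclidean_space"
  assumes "open S" "higher_differentiable_on S h n" "higher_differentiable_on T g n" "h ` S \<subseteq> T"
  shows "higher_differentiable_on S (g \<circ> h) n"
  using assms(2,3)
proof (induction n arbitrary: g)
  case 0
  then show ?case
    using continuous_on_compose2[of T g S h] assms(4) by (simp add: comp_def)
next
  case (Suc n)
  let ?Dh = "\<lambda>x. frechet_derivative h (at x)"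
  let ?Dg = "\<lambda>y. frechet_derivative g (at y)"
  have hn: "higher_differentiable_on S h n"
    using Suc.prems(1) higher_differentiable_on_SucD by blast
  show ?case
  proof (rule higher_differentiable_on_SucI[OF assms(1)])
    fix x assume "x \<in> S"
    then have dh: "(h has_derivative ?Dh x) (at x)"
      and dg: "(g has_derivative ?Dg (h x)) (at (h x))"
      using Suc.prems assms(4) by (auto simp: frechet_derivative_works)
    have expand: "?Dg (h x) w = (\<Sum>i\<in>Basis. (w \<bullet> i) *\<^sub>R ?Dg (h x) i)" for w
    proof -
      interpret linear "?Dg (h x)" using dg by (rule has_derivative_linear)
      have "?Dg (h x) (\<Sum>i\<in>Basis. (w \<bullet> i) *\<^sub>R i) = (\<Sum>i\<in>Basis. (w \<bullet> i) *\<^sub>R ?Dg (h x) i)"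
        by (simp only: sum scale)
      then show ?thesis by (simp add: euclidean_representation)
    qed
    have "?Dg (h x) \<circ> ?Dh x
        = (\<lambda>v. \<Sum>i\<in>Basis. (?Dh x v \<bullet> i) *\<^sub>R ((\<lambda>y. ?Dg y i) \<circ> h) x)"
      unfolding comp_def by (rule ext) (rule expand)
    then show "((g \<circ> h) has_derivative
        (\<lambda>v. \<Sum>i\<in>Basis. (?Dh x v \<bullet> i) *\<^sub>R ((\<lambda>y. ?Dg y i) \<circ> h) x)) (at x)"
      using diff_chain_at[OF dh dg] by metis
  next
    fix v
    have outer: "higher_differentiable_on S ((\<lambda>y. ?Dg y i) \<circ> h) n" for i
      by (rule Suc.IH[OF hn]) (use Suc.prems(2) in simp)
    have inner: "higher_differentiable_on S (\<lambda>x. ?Dh x v \<bullet> i) n" for i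
      by (rule higher_differentiable_on_bilinear[OF bounded_bilinear_inner assms(1) _
            higher_differentiable_on_const]) (use Suc.prems(1) in simp)
    show "higher_differentiable_on S
        (\<lambda>x. \<Sum>i\<in>Basis. (?Dh x v \<bullet> i) *\<^sub>R ((\<lambda>y. ?Dg y i) \<circ> h) x) n"
      by (rule higher_differentiable_on_sum[OF assms(1) finite_Basis])
        (rule higher_differentiable_on_bilinear[OF bounded_bilinear_scaleR assms(1) inner outer])
  qed
qed

section \<open>Lorentzian linear algebra\<close>

lemma lcross_components:
  "lcross a x $ 1 = a$2 * x$3 - a$3 * x$2"
  "lcross a x $ 2 = a$3 * x$1 - a$1 * x$3"
  "lcross a x $ 3 = a$2 * x$1 - a$1 * x$2"
  by (simp_all add: lcross_def cross3_def Let_def)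

lemma bounded_bilinear_lor: "bounded_bilinear lor"
  by (auto simp: bilinear_conv_bounded_bilinear[symmetric] bilinear_def lor_def algebra_simps
      intro!: linearI)

lemma bounded_bilinear_lcross: "bounded_bilinear lcross"
  by (auto simp: bilinear_conv_bounded_bilinear[symmetric] bilinear_def vec_eq_iff forall_3
      lcross_components algebra_simps intro!: linearI)

text \<open>For a spacelike \<open>a\<close> with \<open>\<langle>a, a\<rangle> = \<sigma>\<^sup>2\<close> this is \<open>(\<sigma>\<^sup>2 - \<sigma> J)\<close> applied to the projection of the
  time axis \<open>w\<close> to the plane orthogonal to \<open>a\<close>, where
  \<open>J = a \<times> -\<close>; the sign of the middle term comes from \<open>\<langle>w, a\<rangle> = - a\<^sub>3\<close>. It is an eigenvector of
  \<open>J\<close> for \<open>- \<sigma>\<close>. The time axis is used because it is orthogonal to no lightlike vector.\<close>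

definition null_companion :: "real \<Rightarrow> real^3 \<Rightarrow> real^3" where
  "null_companion \<sigma> a =
     \<sigma>\<^sup>2 *\<^sub>R axis 3 1 + (a$3) *\<^sub>R a + (- \<sigma>) *\<^sub>R lcross a (axis 3 1)"

lemma null_companion_components:
  "null_companion \<sigma> a $ 1 = a$3 * a$1 - \<sigma> * a$2"
  "null_companion \<sigma> a $ 2 = a$3 * a$2 + \<sigma> * a$1"
  "null_companion \<sigma> a $ 3 = \<sigma>\<^sup>2 + (a$3)\<^sup>2"
  by (simp_all add: null_companion_def lcross_components axis_def power2_eq_square)

lemma null_companion_orthogonal:
  "\<sigma>\<^sup>2 = lor a a \<Longrightarrow> lor (null_companion \<sigma> a) a = 0"
  unfolding lor_def null_companion_components by algebra

lemma null_companion_null: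
  "\<sigma>\<^sup>2 = lor a a \<Longrightarrow> lor (null_companion \<sigma> a) (null_companion \<sigma> a) = 0"
  unfolding lor_def null_companion_components by algebra

text \<open>The right-hand side shows when the product vanishes: for an eigenvector \<open>x\<close> of \<open>J\<close> with
  eigenvalue \<open>\<sigma>\<close> it is \<open>- 2 \<sigma>\<^sup>2 x\<^sub>3\<close>.\<close>

lemma lor_null_companion:
  assumes "lor a x = 0"
  shows "lor (null_companion \<sigma> a) x = - \<sigma> * (\<sigma> * x$3 + lcross a x $ 3)"
  using assms unfolding lor_def null_companion_components lcross_components by algebra

text \<open>Both \<open>\<sigma> x - J x\<close> and the null companion lie on the null line of \<open>J\<close> for the eigenvalue \<open>- \<sigma>\<close>,
  so they are proportional. Taking products with \<open>x\<close> determines the factor, because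
  \<open>\<langle>J x, x\<rangle> = 0\<close>.\<close>

lemma null_companion_identity:
  assumes "\<sigma>\<^sup>2 = lor a a" "lor a x = 0"
  shows "lor (null_companion \<sigma> a) x *\<^sub>R (\<sigma> *\<^sub>R x - lcross a x)
    = (\<sigma> * lor x x) *\<^sub>R null_companion \<sigma> a"
  using assms
  unfolding vec_eq_iff forall_3 vector_minus_component vector_scaleR_component real_scaleR_def
    lor_def null_companion_components lcross_components
  apply (intro conjI)
  subgoal by algebra
  subgoal by algebra
  subgoal by algebra
  done

text \<open>The product \<open>a \<times> x\<close> is orthogonal to \<open>a\<close> and to \<open>x\<close>, and so is \<open>x\<close> itself; if \<open>a\<close> and \<open>x\<close> are
  independent, such vectors form a line, and otherwise \<open>a \<times> x = 0\<close>. The factor \<open>k\<close> is read off from the third coordinate, which is non-zero for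
  every lightlike vector.\<close>

lemma lcross_null:
  assumes "lor a x = 0" "lor x x = 0" "x \<noteq> 0"
  obtains k where "lcross a x = k *\<^sub>R x" "k\<^sup>2 = lor a a" "x$3 \<noteq> 0"
proof -
  have x3: "x$3 \<noteq> 0"
  proof
    assume 0: "x$3 = 0"
    then have "(x$1)\<^sup>2 + (x$2)\<^sup>2 = 0" using assms(2) by (simp add: lor_def power2_eq_square)
    then have "x = 0" using 0 by (simp add: vec_eq_iff forall_3)
    then show False using assms(3) by simp
  qed
  define k where "k = lcross a x $ 3 / x$3"
  have k: "k * x$3 = a$2 * x$1 - a$1 * x$2" using x3 by (simp add: k_def lcross_components)
  have o: "a$1 * x$1 + a$2 * x$2 - a$3 * x$3 = 0" "x$1 * x$1 + x$2 * x$2 - x$3 * x$3 = 0"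
    using assms by (auto simp: lor_def)
  have "x$3 * (a$2 * x$3 - a$3 * x$2) = x$3 * (k * x$1)" using k o by algebra
  moreover have "x$3 * (a$3 * x$1 - a$1 * x$3) = x$3 * (k * x$2)" using k o by algebra
  ultimately have 1: "lcross a x = k *\<^sub>R x"
    using x3 k by (simp add: vec_eq_iff forall_3 lcross_components)
  have "(x$3)\<^sup>2 * k\<^sup>2 = (x$3)\<^sup>2 * lor a a" unfolding lor_def using k o by algebra
  then have "k\<^sup>2 = lor a a" using x3 by simp
  with 1 x3 that show ?thesis by blast
qed

section \<open>Charts\<close>

lemma chart_inj: "is_chart X c \<Longrightarrow> inj_on (snd c) (fst c)"
  unfolding is_chart_def
  using homeomorphic_imp_injective_map openin_subset[of X "fst c"]
  by (metis inf.absorb_iff2 topspace_subtopology)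

lemma param_inverse: "is_chart X c \<Longrightarrow> q \<in> fst c \<Longrightarrow> param c (snd c q) = q"
  unfolding param_def by (simp add: chart_inj)

lemma openin_chart_preimage:
  assumes "is_chart X c" "open V"
  shows "openin X {q \<in> fst c. snd c q \<in> V}"
proof -
  have o: "openin X (fst c)" using assms(1) by (simp add: is_chart_def)
  have "continuous_map (subtopology X (fst c)) euclidean (snd c)"
    using assms(1) homeomorphic_imp_continuous_map
    unfolding is_chart_def by (metis continuous_map_in_subtopology)
  then have "openin (subtopology X (fst c)) {q \<in> topspace (subtopology X (fst c)). snd c q \<in> V}"
    using assms(2) by (intro openin_continuous_map_preimage) auto
  moreover have "topspace (subtopology X (fst c)) = fst c"
    using openin_subset[OF o] by auto
  ultimately show ?thesis using o by (simp only: openin_open_subtopology)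
qed

lemma open_chart_image:
  assumes "is_chart X c" "openin X U"
  shows "open (snd c ` (fst c \<inter> U))"
proof -
  have "openin (subtopology X (fst c)) (fst c \<inter> U)"
    using assms(2) by (simp add: openin_subtopology_Int2)
  then have "openin (top_of_set (snd c ` fst c)) (snd c ` (fst c \<inter> U))"
    using assms(1) homeomorphic_imp_open_map unfolding is_chart_def open_map_def by blast
  then show ?thesis
    using assms(1) unfolding is_chart_def by (metis openin_open_eq)
qed

text \<open>In another chart the map is the given coordinate expression composed with a change of
  coordinates, so one chart that covers \<open>U\<close> suffices.\<close>

lemma smooth_map_on_via_chart:
  assumes A: "smooth_2_manifold X A" and c: "c \<in> A"
    and U: "openin X U" "U \<subseteq> fst c" and g: "smooth_on (snd c ` U) g"
  shows "smooth_map_on A U (g \<circ> snd c)"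
  unfolding smooth_map_on_def
proof
  fix d assume d: "d \<in> A"
  have charts: "is_chart X d" "compatible_charts d c"
    using A c d by (auto simp: smooth_2_manifold_def)
  let ?S = "snd d ` (fst d \<inter> U)"
  have "higher_differentiable_on ?S (g \<circ> (snd c \<circ> param d)) n" for n
  proof (rule higher_differentiable_on_compose)
    show "open ?S" using open_chart_image[OF charts(1) U(1)] .
    have "smooth_on (snd d ` (fst d \<inter> fst c)) (snd c \<circ> param d)"
      using charts by (simp add: compatible_charts_def)
    then show "higher_differentiable_on ?S (snd c \<circ> param d) n"
      using U(2) unfolding smooth_on_def by (blast intro: higher_differentiable_on_subset)
    show "higher_differentiable_on (snd c ` U) g n" using g by (simp add: smooth_on_def)
    show "(snd c \<circ> param d) ` ?S \<subseteq> snd c ` U"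
      using param_inverse[OF charts(1)] by auto
  qed
  then show "smooth_on ?S (g \<circ> snd c \<circ> param d)"
    by (simp add: smooth_on_def comp_assoc)
qed


section \<open>L-coordinates at lightlike points\<close>

text \<open>The last hypothesis is linear independence of \<open>a\<close> and \<open>x\<close>: since \<open>x\<^sub>3 \<noteq> 0\<close>, these are up to a
  scalar the only coefficients that a dependency could have. The square of the eigenvalue of
  \<open>a \<times> -\<close> at \<open>x\<close> is \<open>\<langle>a, a\<rangle>\<close>, so only \<open>a \<times> x = 0\<close> has to be excluded.\<close>

lemma lor_pos_if_independent:
  assumes "lor a x = 0" "lor x x = 0" "x \<noteq> 0" "x$3 *\<^sub>R a \<noteq> a$3 *\<^sub>R x"
  shows "lor a a > 0"
proof -
  obtain k where k: "lcross a x = k *\<^sub>R x" "k\<^sup>2 = lor a a"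
    using lcross_null assms by blast
  have "k \<noteq> 0"
  proof
    assume "k = 0"
    then have "lcross a x $ i = 0" for i using k by simp
    from this[of 1] this[of 2] have "x$3 *\<^sub>R a = a$3 *\<^sub>R x"
      by (simp add: lcross_components vec_eq_iff forall_3 algebra_simps)
    then show False using assms(4) by simp
  qed
  then have "k\<^sup>2 > 0" by simp
  then show ?thesis using k by simp
qed

lemma surface_smooth_in_chart:
  assumes "surface X A f" "c \<in> A"
  shows "is_chart X c" "open (snd c ` fst c)" "smooth_on (snd c ` fst c) (f \<circ> param c)"
proof -
  show c: "is_chart X c"
    using assms by (simp add: surface_def smooth_2_manifold_def)
  then show "open (snd c ` fst c)" by (simp add: is_chart_def)
  have "fst c \<inter> topspace X = fst c"
    using c openin_subset unfolding is_chart_def by blast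
  then show "smooth_on (snd c ` fst c) (f \<circ> param c)"
    using assms unfolding surface_def smooth_map_on_def by metis
qed

lemma linear_differential:
  assumes "surface X A f" "c \<in> A" "q \<in> fst c"
  shows "linear (differential f c q)"
proof -
  have "higher_differentiable_on (snd c ` fst c) (f \<circ> param c) (Suc 0)"
    using surface_smooth_in_chart(3)[OF assms(1,2)] unfolding smooth_on_def by blast
  then have "(f \<circ> param c) differentiable (at (snd c q))"
    using assms(3) by auto
  then show ?thesis
    unfolding differential_def by (rule linear_frechet_derivative)
qed

lemma higher_differentiable_on_coordinate_derivative:
  assumes "surface X A f" "c \<in> A"
  shows "higher_differentiable_on (snd c ` fst c)
    (\<lambda>y. frechet_derivative (f \<circ> param c) (at y) v) n"
proof -
  have "higher_differentiable_on (snd c ` fst c) (f \<circ> param c) (Suc n)"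
    using surface_smooth_in_chart(3)[OF assms] unfolding smooth_on_def by blast
  then show ?thesis by simp
qed

text \<open>The vector \<open>f\<^sub>v\<close> is null by the definition of L-coordinates. As the differential is
  injective, \<open>f\<^sub>u\<close> is independent of it, and the vectors orthogonal to a lightlike vector are
  spacelike unless they are multiples of it.\<close>

lemma L_coordinates_at_lightlike:
  assumes S: "surface X A f" and L: "L_coordinates X A f p c"
    and q: "q \<in> fst c" "q \<in> LD X A f"
  shows "lightlike (f_v f c q)" "spacelike (f_u f c q)" "lor (f_u f c q) (f_v f c q) = 0"
proof -
  let ?a = "f_u f c q" and ?x = "f_v f c q" and ?D = "differential f c q"
  have c: "c \<in> A" using L by (simp add: L_coordinates_def)
  interpret linear ?D using linear_differential[OF S c q(1)] .
  have inj: "inj ?D" using S c q(1) by (auto simp: surface_def)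
  show orth: "lor ?a ?x = 0" using L q by (simp add: L_coordinates_def)
  have "metric f c q e_v e_v = 0" using L q by (auto simp: L_coordinates_def)
  then have null: "lor ?x ?x = 0" by (simp add: metric_def f_v_def)
  have D0: "?D w = 0 \<Longrightarrow> w = 0" for w using inj zero by (metis injD)
  have x: "?x \<noteq> 0"
    using D0[of e_v] by (auto simp: f_v_def axis_eq_0_iff)
  then show "lightlike ?x" using null by (simp add: lightlike_def)
  have "?x$3 *\<^sub>R ?a \<noteq> ?a$3 *\<^sub>R ?x"
  proof
    assume "?x$3 *\<^sub>R ?a = ?a$3 *\<^sub>R ?x"
    then have "?D (?x$3 *\<^sub>R e_u - ?a$3 *\<^sub>R e_v) = 0"
      by (simp add: diff scale f_u_def f_v_def)
    then have "?x$3 *\<^sub>R e_u - ?a$3 *\<^sub>R e_v = 0" by (rule D0)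
    then have "(?x$3 *\<^sub>R e_u - ?a$3 *\<^sub>R e_v) $ 1 = 0" by simp
    then have "?x$3 = 0" by (simp add: axis_def)
    then show False using lcross_null[OF orth null x] by blast
  qed
  then have "lor ?a ?a > 0" using lor_pos_if_independent orth null x by blast
  then show "spacelike ?a" by (auto simp: spacelike_def lor_def)
qed

text \<open>At every lightlike point \<open>f\<^sub>u \<times> f\<^sub>v = \<plusminus>\<surd>E f\<^sub>v\<close>. The sign is that of the product of the third
  coordinates of \<open>f\<^sub>u \<times> f\<^sub>v\<close> and \<open>f\<^sub>v\<close>, which is continuous on the whole chart and non-zero at \<open>p\<close>.
  So the sign is constant on the lightlike points near \<open>p\<close>: the coordinates do have one of the two
  orientations, and \<open>\<epsilon>\<close> is the sign at \<open>p\<close>.\<close>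

lemma orientation_at_base_point:
  assumes S: "surface X A f" and p: "lightlike_point X A f p" and L: "L_coordinates X A f p c"
    and pos: "p_oriented_coordinates X A f p c \<Longrightarrow> \<epsilon> = 1"
    and neg: "n_oriented_coordinates X A f p c \<Longrightarrow> \<epsilon> = - 1"
  shows "\<epsilon>\<^sup>2 = 1"
    "lcross (f_u f c p) (f_v f c p) = (\<epsilon> * sqrt (coeff_E f c p)) *\<^sub>R f_v f c p"
proof -
  have c: "c \<in> A" "p \<in> fst c" using L by (auto simp: L_coordinates_def)
  have pL: "p \<in> LD X A f" using p by (simp add: LD_def)
  note ch = surface_smooth_in_chart[OF S c(1)]
  define Fu where "Fu = (\<lambda>y. frechet_derivative (f \<circ> param c) (at y) e_u)"
  define Fv where "Fv = (\<lambda>y. frechet_derivative (f \<circ> param c) (at y) e_v)"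
  have fu: "f_u f c q = Fu (snd c q)" and fv: "f_v f c q = Fv (snd c q)" for q
    by (simp_all add: Fu_def Fv_def f_u_def f_v_def differential_def)
  have cont: "continuous_on (snd c ` fst c) Fu" "continuous_on (snd c ` fst c) Fv"
    using higher_differentiable_on_coordinate_derivative[OF S c(1), of _ 0]
    by (simp_all add: Fu_def Fv_def)
  have key: "\<exists>k. lcross (f_u f c q) (f_v f c q) = k *\<^sub>R f_v f c q \<and> k\<^sup>2 = coeff_E f c q
      \<and> f_v f c q $ 3 \<noteq> 0 \<and> coeff_E f c q > 0"
    if "q \<in> fst c" "q \<in> LD X A f" for q
  proof -
    note l = L_coordinates_at_lightlike[OF S L that]
    obtain k where "lcross (f_u f c q) (f_v f c q) = k *\<^sub>R f_v f c q"
      "k\<^sup>2 = lor (f_u f c q) (f_u f c q)" "f_v f c q $ 3 \<noteq> 0"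
      using lcross_null l unfolding lightlike_def by metis
    then show ?thesis
      using l(2) by (auto simp: coeff_E_def metric_def spacelike_def f_u_def)
  qed
  obtain k where k: "lcross (f_u f c p) (f_v f c p) = k *\<^sub>R f_v f c p" "k\<^sup>2 = coeff_E f c p"
    "f_v f c p $ 3 \<noteq> 0" "coeff_E f c p > 0"
    using key[OF c(2) pL] by blast
  define \<tau> where "\<tau> = sgn k"
  have k0: "k \<noteq> 0" using k by auto
  then have tau: "\<tau> = 1 \<or> \<tau> = -1" by (auto simp: \<tau>_def sgn_if)
  have root: "k' = \<tau> * sqrt E" if "k'\<^sup>2 = E" "\<tau> * k' > 0" for k' E :: real
    using that tau by (auto simp: abs_if simp flip: that(1))
  \<comment> \<open>positive exactly where the sign of the eigenvalue is still the one at \<open>p\<close>\<close>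
  define h where "h = (\<lambda>y. \<tau> * (lcross (Fu y) (Fv y) $ 3 * Fv y $ 3))"
  have ch_h: "continuous_on (snd c ` fst c) h"
    unfolding h_def
    by (intro continuous_intros bounded_bilinear.continuous_on[OF bounded_bilinear_lcross] cont)
  define W where "W = {q \<in> fst c. snd c q \<in> snd c ` fst c \<inter> h -` {0<..}}"
  have openW: "openin X W" unfolding W_def
    using ch ch_h by (intro openin_chart_preimage continuous_open_preimage) auto
  have pW: "p \<in> W"
  proof -
    have "h (snd c p) = (\<tau> * k) * (f_v f c p $ 3)\<^sup>2"
      using k(1) by (simp add: h_def flip: fu fv) (simp add: power2_eq_square)
    moreover have "\<tau> * k > 0" using k0 by (simp add: \<tau>_def sgn_if)
    ultimately have "h (snd c p) > 0" using k(3) by simp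
    then show ?thesis using c by (simp add: W_def)
  qed
  have W: "lcross (f_u f c q) (f_v f c q) = (\<tau> * lnorm (f_u f c q)) *\<^sub>R f_v f c q"
    if q: "q \<in> W" "q \<in> LD X A f" for q
  proof -
    have qc: "q \<in> fst c" and hq: "h (snd c q) > 0" using q by (auto simp: W_def)
    obtain k' where k': "lcross (f_u f c q) (f_v f c q) = k' *\<^sub>R f_v f c q"
      "k'\<^sup>2 = coeff_E f c q" "f_v f c q $ 3 \<noteq> 0" "coeff_E f c q > 0"
      using key[OF qc q(2)] by blast
    have "h (snd c q) = (\<tau> * k') * (f_v f c q $ 3)\<^sup>2"
      using k'(1) by (simp add: h_def flip: fu fv) (simp add: power2_eq_square)
    then have "\<tau> * k' > 0" using hq by (simp add: zero_less_mult_iff)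
    then have "k' = \<tau> * sqrt (coeff_E f c q)" using root k'(2) by blast
    then show ?thesis
      using k' by (simp add: lnorm_def coeff_E_def metric_def f_u_def)
  qed
  have "\<epsilon> = \<tau>"
    using tau
  proof
    assume t: "\<tau> = 1"
    have "p_oriented_coordinates X A f p c"
      unfolding p_oriented_coordinates_def
      using openW pW W t L_coordinates_at_lightlike[OF S L]
      by (intro exI[of _ W]) (auto simp: p_oriented_pair_def W_def)
    then show ?thesis using pos t by simp
  next
    assume t: "\<tau> = -1"
    have "n_oriented_coordinates X A f p c"
      unfolding n_oriented_coordinates_def
      using openW pW W t L_coordinates_at_lightlike[OF S L]
      by (intro exI[of _ W]) (auto simp: n_oriented_pair_def W_def)
    then show ?thesis using neg t by simp
  qed
  then show "\<epsilon>\<^sup>2 = 1" using tau by auto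
  show "lcross (f_u f c p) (f_v f c p) = (\<epsilon> * sqrt (coeff_E f c p)) *\<^sub>R f_v f c p"
    using W[OF pW pL] k(4) \<open>\<epsilon> = \<tau>\<close> by (simp add: lnorm_def coeff_E_def metric_def f_u_def)
qed

section \<open>The L-Gauss map\<close>

lemma higher_differentiable_on_null_companion:
  assumes "open S" "higher_differentiable_on S s n" "higher_differentiable_on S a n"
  shows "higher_differentiable_on S (\<lambda>y. null_companion (s y) (a y)) n"
proof -
  have neg: "higher_differentiable_on S (\<lambda>y. - s y) n"
    using higher_differentiable_on_mult[OF assms(1) higher_differentiable_on_const assms(2),
        of "-1"] by simp
  note scaleR = higher_differentiable_on_bilinear[OF bounded_bilinear_scaleR assms(1)]
  have "higher_differentiable_on S (\<lambda>y. a y \<bullet> axis 3 1) n"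
    by (rule higher_differentiable_on_bilinear[OF bounded_bilinear_inner assms(1,3)
          higher_differentiable_on_const])
  then have third: "higher_differentiable_on S (\<lambda>y. a y $ 3) n"
    by (simp add: inner_axis)
  have cross: "higher_differentiable_on S (\<lambda>y. lcross (a y) (axis 3 1)) n"
    by (rule higher_differentiable_on_bilinear[OF bounded_bilinear_lcross assms(1,3)
          higher_differentiable_on_const])
  show ?thesis
    unfolding null_companion_def power2_eq_square
    by (rule higher_differentiable_on_add[OF assms(1)
          higher_differentiable_on_add[OF assms(1)
            scaleR[OF higher_differentiable_on_mult[OF assms(1,2,2)]
              higher_differentiable_on_const]
            scaleR[OF third assms(3)]]
          scaleR[OF neg cross]])
qed

lemma L_Gauss_algebra:
  fixes a x :: "real^3" and \<sigma> :: real
  defines "N \<equiv> null_companion \<sigma> a"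
  defines "\<psi> \<equiv> inverse (lor N x) *\<^sub>R N"
  assumes \<sigma>: "\<sigma>\<^sup>2 = lor a a" and ax: "lor a x = 0" and den: "lor N x \<noteq> 0"
  shows "lcross a x = \<sigma> *\<^sub>R (x - lor x x *\<^sub>R \<psi>)"
    "lor \<psi> \<psi> = 0" "lor \<psi> a = 0" "lor \<psi> x = 1"
proof -
  have scale: "lor (r *\<^sub>R y) z = r * lor y z" "lor y (r *\<^sub>R z) = r * lor y z" for r y z
    by (simp_all add: lor_def algebra_simps)
  show "lor \<psi> \<psi> = 0" "lor \<psi> a = 0" "lor \<psi> x = 1"
    using null_companion_null[OF \<sigma>] null_companion_orthogonal[OF \<sigma>] den
    by (simp_all add: \<psi>_def N_def scale)
  have "inverse (lor N x) *\<^sub>R (lor N x *\<^sub>R (\<sigma> *\<^sub>R x - lcross a x))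
      = inverse (lor N x) *\<^sub>R ((\<sigma> * lor x x) *\<^sub>R N)"
    using null_companion_identity[OF \<sigma> ax] by (simp add: N_def)
  then have "\<sigma> *\<^sub>R x - lcross a x = (\<sigma> * lor x x) *\<^sub>R \<psi>"
    using den by (simp add: \<psi>_def mult.commute)
  then show "lcross a x = \<sigma> *\<^sub>R (x - lor x x *\<^sub>R \<psi>)"
    by (simp add: algebra_simps)
qed

theorem lemma4p2:
  fixes X :: "'a topology" and A :: "'a chart set" and f :: "'a \<Rightarrow> real^3"
    and p :: 'a and c :: "'a chart" and \<epsilon> :: real
  assumes "surface X A f"
    and "mixed_type X A f"
    and "nondegenerate_lightlike_point X A f p"
    and "L_coordinates X A f p c"
    and "p_oriented_coordinates X A f p c \<Longrightarrow> \<epsilon> = 1"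
    and "n_oriented_coordinates X A f p c \<Longrightarrow> \<epsilon> = - 1"
  shows "\<exists>U \<psi>. openin X U \<and> p \<in> U \<and> U \<subseteq> fst c \<and> smooth_map_on A U \<psi> \<and>
    (\<forall>q\<in>U. lcross (f_u f c q) (f_v f c q) =
        (\<epsilon> * sqrt (coeff_E f c q)) *\<^sub>R (f_v f c q - coeff_G f c q *\<^sub>R \<psi> q)) \<and>
    (\<forall>q\<in>U. lor (\<psi> q) (\<psi> q) = 0 \<and> lor (\<psi> q) (f_u f c q) = 0 \<and> lor (\<psi> q) (f_v f c q) = 1)"
proof -
  have c: "c \<in> A" "p \<in> fst c" using assms(4) by (auto simp: L_coordinates_def)
  note ch = surface_smooth_in_chart[OF assms(1) c(1)]
  have p: "lightlike_point X A f p" using assms(3) by (simp add: nondegenerate_lightlike_point_def)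
  then have pL: "p \<in> LD X A f" by (simp add: LD_def)
  note eps = orientation_at_base_point[OF assms(1) p assms(4-6)]
  note atp = L_coordinates_at_lightlike[OF assms(1,4) c(2) pL]

  define V where "V = snd c ` fst c"
  define Fu where "Fu = (\<lambda>y. frechet_derivative (f \<circ> param c) (at y) e_u)"
  define Fv where "Fv = (\<lambda>y. frechet_derivative (f \<circ> param c) (at y) e_v)"
  have fu: "f_u f c q = Fu (snd c q)" and fv: "f_v f c q = Fv (snd c q)" for q
    by (simp_all add: Fu_def Fv_def f_u_def f_v_def differential_def)
  have smooth: "higher_differentiable_on V Fu n" "higher_differentiable_on V Fv n" for n
    using higher_differentiable_on_coordinate_derivative[OF assms(1) c(1)]
    by (simp_all add: Fu_def Fv_def V_def)

  define E where "E = (\<lambda>y. lor (Fu y) (Fu y))"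
  define \<sigma> where "\<sigma> = (\<lambda>y. \<epsilon> * sqrt (E y))"
  define N where "N = (\<lambda>y. null_companion (\<sigma> y) (Fu y))"
  define d where "d = (\<lambda>y. lor (N y) (Fv y))"
  define \<Psi> where "\<Psi> = (\<lambda>y. inverse (d y) *\<^sub>R N y)"
  have E: "coeff_E f c q = E (snd c q)" for q
    by (simp add: E_def coeff_E_def metric_def flip: f_u_def fu)

  \<comment> \<open>The square root in \<open>\<sigma>\<close> is smooth on \<open>V1\<close>, and the quotient \<open>\<Psi>\<close> on the smaller \<open>V2\<close>.\<close>
  define V1 where "V1 = V \<inter> E -` {0<..}"
  have sE: "higher_differentiable_on V E n" for n
    unfolding E_def using smooth ch(2)
    by (intro higher_differentiable_on_bilinear[OF bounded_bilinear_lor]) (auto simp: V_def)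
  have V1: "open V1"
    unfolding V1_def using sE[of 0] ch(2)
    by (intro continuous_open_preimage) (auto simp: V_def)
  have sub1: "V1 \<subseteq> V" by (auto simp: V1_def)
  note on_V1 = higher_differentiable_on_subset[OF _ sub1]
  have sN: "higher_differentiable_on V1 N n" for n
    unfolding N_def \<sigma>_def
    by (intro higher_differentiable_on_null_companion higher_differentiable_on_mult
        higher_differentiable_on_const higher_differentiable_on_sqrt V1 on_V1 smooth sE)
      (simp add: V1_def)
  have sd: "higher_differentiable_on V1 d n" for n
    unfolding d_def
    by (intro higher_differentiable_on_bilinear[OF bounded_bilinear_lor] V1 sN on_V1 smooth)

  define V2 where "V2 = V1 \<inter> d -` (- {0})"
  have V2: "open V2"
    unfolding V2_def using sd[of 0] V1 by (intro continuous_open_preimage) auto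
  have sub2: "V2 \<subseteq> V1" by (auto simp: V2_def)
  have "higher_differentiable_on V2 \<Psi> n" for n
    unfolding \<Psi>_def
    by (intro higher_differentiable_on_bilinear[OF bounded_bilinear_scaleR]
        higher_differentiable_on_inverse V2 higher_differentiable_on_subset[OF _ sub2] sN sd)
      (simp add: V2_def)
  then have s\<Psi>: "smooth_on S \<Psi>" if "S \<subseteq> V2" for S
    using that higher_differentiable_on_subset unfolding smooth_on_def by blast

  define U where "U = {q \<in> fst c. snd c q \<in> V2}"
  have openU: "openin X U"
    unfolding U_def using ch(1) V2 by (rule openin_chart_preimage)
  have \<sigma>2: "(\<sigma> y)\<^sup>2 = lor (Fu y) (Fu y)" if "E y > 0" for y
    using that eps(1) by (simp add: \<sigma>_def power_mult_distrib) (simp add: E_def)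
  have pU: "p \<in> U"
  proof -
    have E0: "E (snd c p) > 0" using atp(2) by (simp add: E_def fu spacelike_def)
    have cross: "lcross (Fu (snd c p)) (Fv (snd c p)) = \<sigma> (snd c p) *\<^sub>R Fv (snd c p)"
      using eps(2) by (simp add: \<sigma>_def fu fv E)
    have orth: "lor (Fu (snd c p)) (Fv (snd c p)) = 0" using atp(3) by (simp add: fu fv)
    have "Fv (snd c p) $ 3 \<noteq> 0"
      using lcross_null[OF atp(3)] atp(1) unfolding lightlike_def fv by blast
    moreover have "\<sigma> (snd c p) \<noteq> 0" using \<sigma>2[OF E0] E0 by (auto simp: E_def)
    ultimately have "d (snd c p) \<noteq> 0"
      unfolding d_def N_def lor_null_companion[OF orth] cross by simp
    then show ?thesis using c E0 by (auto simp: U_def V2_def V1_def V_def)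
  qed
  have alg: "lcross (f_u f c q) (f_v f c q) =
        (\<epsilon> * sqrt (coeff_E f c q)) *\<^sub>R (f_v f c q - coeff_G f c q *\<^sub>R (\<Psi> \<circ> snd c) q)"
      "lor ((\<Psi> \<circ> snd c) q) ((\<Psi> \<circ> snd c) q) = 0" "lor ((\<Psi> \<circ> snd c) q) (f_u f c q) = 0"
      "lor ((\<Psi> \<circ> snd c) q) (f_v f c q) = 1" if q: "q \<in> U" for q
  proof -
    let ?y = "snd c q"
    have E0: "E ?y > 0" and d0: "d ?y \<noteq> 0" using q by (auto simp: U_def V2_def V1_def)
    have orth: "lor (Fu ?y) (Fv ?y) = 0"
      using assms(4) q by (auto simp: L_coordinates_def U_def simp flip: fu fv)
    have G: "coeff_G f c q = lor (Fv ?y) (Fv ?y)"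
      by (simp add: coeff_G_def metric_def flip: f_v_def fv)
    note g = L_Gauss_algebra[OF \<sigma>2[OF E0] orth d0[unfolded d_def N_def]]
    show "lcross (f_u f c q) (f_v f c q) =
        (\<epsilon> * sqrt (coeff_E f c q)) *\<^sub>R (f_v f c q - coeff_G f c q *\<^sub>R (\<Psi> \<circ> snd c) q)"
      "lor ((\<Psi> \<circ> snd c) q) ((\<Psi> \<circ> snd c) q) = 0" "lor ((\<Psi> \<circ> snd c) q) (f_u f c q) = 0"
      "lor ((\<Psi> \<circ> snd c) q) (f_v f c q) = 1"
      using g unfolding comp_def fu fv E G \<Psi>_def d_def N_def \<sigma>_def by blast+
  qed
  have "smooth_map_on A U (\<Psi> \<circ> snd c)"
    using assms(1) c(1) openU s\<Psi>[of "snd c ` U"]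
    by (intro smooth_map_on_via_chart) (auto simp: surface_def U_def)
  then show ?thesis
    using openU pU alg by (intro exI[of _ U] exI[of _ "\<Psi> \<circ> snd c"]) (auto simp: U_def)
qed

end
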